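(* Let $P \subseteq \mathbb{R}^n$, let $V$ be the affine hull of $P$, let $\pi \in \mathbb{Z}^n$ and $\pi_0 \in \mathbb{Z}$, and suppose $x \in P \setminus P^{(\pi,\pi_0)}$. If $\operatorname{proj}_V \pi = 0$, then $P^{(\pi,\pi_0)} = \emptyset$ and $P \cap \mathbb{Z}^n = \emptyset$. Otherwise, there exists a point $x' \in V \setminus P$ such that \[ \|x - x'\| \le \frac{1}{\|\operatorname{proj}_V \pi\|}. \]
   Context: $\|\cdot\|$ is the Euclidean norm on $\mathbb{R}^n$. For $P \subseteq \mathbb{R}^n$, $\pi \in \mathbb{Z}^n$, $\pi_0 \in \mathbb{Z}$, define $P^{(\pi,\pi_0)} := \operatorname{conv}\left(\{x \in P : \pi^T x \le \pi_0\} \cup \{x \in P : \pi^T x \ge \pi_0+1\}\right)$. For an affine subspace $V$ of $\mathbb{R}^n$, $\operatorname{proj}_V \pi$ denotes the orthogonal projection of the vector $\pi$ onto the linear direction space $\{u - w : u, w \in V\}$ of $V$. *)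

theory Defs
  imports "HOL-Analysis.Analysis"
begin

definition integer_points :: "(real ^ 'n) set" where
  "integer_points = {x. \<forall>i. x $ i \<in> \<int>}"

definition split_hull :: "(real ^ 'n) set \<Rightarrow> real ^ 'n \<Rightarrow> int \<Rightarrow> (real ^ 'n) set" where
  "split_hull P \<pi> \<pi>\<^sub>0 =
     convex hull ({x \<in> P. \<pi> \<bullet> x \<le> of_int \<pi>\<^sub>0} \<union> {x \<in> P. \<pi> \<bullet> x \<ge> of_int \<pi>\<^sub>0 + 1})"

definition direction_space :: "'a::euclidean_space set \<Rightarrow> 'a set" where
  "direction_space V = {u - w | u w. u \<in> V \<and> w \<in> V}"

text \<open>
  The argument \<open>V\<close> is meant to be a nonempty affine subspace; the projection is onto its
  direction space, not onto \<open>V\<close> itself. The lemmas below show that the description is then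
  well defined.
\<close>

definition proj_direction :: "'a::euclidean_space set \<Rightarrow> 'a \<Rightarrow> 'a" where
  "proj_direction V v =
     (THE p. p \<in> direction_space V \<and> (\<forall>d\<in>direction_space V. orthogonal (v - p) d))"

lemma subspace_direction_space:
  assumes "affine V" "V \<noteq> {}"
  shows "subspace (direction_space V)"
proof -
  obtain a where a: "a \<in> V"
    using assms by blast
  have "direction_space V = {x - a | x. x \<in> V}"
  proof
    show "direction_space V \<subseteq> {x - a | x. x \<in> V}"
    proof
      fix d assume "d \<in> direction_space V"
      then obtain u w where uw: "u \<in> V" "w \<in> V" "d = u - w"
        by (auto simp: direction_space_def)
      have "a + 1 *\<^sub>R (u - w) \<in> V"
        using mem_affine_3_minus[OF assms(1) a uw(1,2)] .
      then show "d \<in> {x - a | x. x \<in> V}"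
        using uw by (force intro: exI[of _ "a + (u - w)"])
    qed
    show "{x - a | x. x \<in> V} \<subseteq> direction_space V"
      using a by (auto simp: direction_space_def)
  qed
  then show ?thesis
    using affine_diffs_subspace_subtract[OF assms(1) a] by (simp add: Setcompr_eq_image)
qed

lemma proj_direction_ex1:
  fixes V :: "'a::euclidean_space set"
  assumes "affine V" "V \<noteq> {}"
  shows "\<exists>!p. p \<in> direction_space V \<and> (\<forall>d\<in>direction_space V. orthogonal (v - p) d)"
proof -
  let ?D = "direction_space V"
  have sub: "subspace ?D"
    by (rule subspace_direction_space[OF assms])
  obtain y z where yz: "y \<in> span ?D" "\<And>w. w \<in> span ?D \<Longrightarrow> orthogonal z w" "v = y + z"
    using orthogonal_subspace_decomp_exists[of ?D v] by blast
  show ?thesis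
  proof (rule ex1I[of _ y])
    show "y \<in> ?D \<and> (\<forall>d\<in>?D. orthogonal (v - y) d)"
      using yz sub by (auto simp: span_eq_iff[THEN iffD2])
  next
    fix p assume p: "p \<in> ?D \<and> (\<forall>d\<in>?D. orthogonal (v - p) d)"
    have "y \<in> ?D"
      using yz sub by (simp add: span_eq_iff[THEN iffD2])
    then have d: "p - y \<in> ?D"
      using p sub by (simp add: subspace_diff)
    have "orthogonal (v - p) (p - y)" "orthogonal (v - y) (p - y)"
      using p d yz(2,3) span_base by auto
    then have "(p - y) \<bullet> (p - y) = 0"
      by (simp add: orthogonal_def inner_diff_left)
    then show "p = y"
      by simp
  qed
qed

lemma proj_direction_eq_iff:
  fixes V :: "'a::euclidean_space set"
  assumes "affine V" "V \<noteq> {}"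
  shows "proj_direction V v = p \<longleftrightarrow>
    p \<in> direction_space V \<and> (\<forall>d\<in>direction_space V. orthogonal (v - p) d)"
  unfolding proj_direction_def
  using theI'[OF proj_direction_ex1[OF assms, of v]] proj_direction_ex1[OF assms, of v]
  by blast

end

theory Submission
  imports Defs
begin

text \<open>
  A point \<open>x\<close> of \<open>P\<close> outside the split hull lies strictly between the hyperplanes
  \<open>\<pi> \<bullet> y = \<pi>\<^sub>0\<close> and \<open>\<pi> \<bullet> y = \<pi>\<^sub>0 + 1\<close>. Let \<open>p\<close> be the projection of \<open>\<pi>\<close>. If \<open>p = 0\<close>, then
  \<open>\<pi> \<bullet> y\<close> is constant on \<open>V\<close>, with a non-integral value. Otherwise the line through \<open>x\<close> in
  direction \<open>p\<close> stays in \<open>V\<close> and meets the two hyperplanes in points whose distance is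
  \<open>1 / \<parallel>p\<parallel>\<close>; since \<open>x\<close> lies on the segment between them, they cannot both belong to \<open>P\<close>.
\<close>

lemma inner_integer_points:
  assumes "x \<in> integer_points" "y \<in> integer_points"
  shows "x \<bullet> y \<in> \<int>"
  using assms by (auto simp: integer_points_def inner_vec_def intro!: Ints_sum Ints_mult)

lemma affine_add_direction:
  assumes "affine V" "x \<in> V" "d \<in> direction_space V"
  shows "x + c *\<^sub>R d \<in> V"
  using assms by (auto simp: direction_space_def intro: mem_affine_3_minus)

text \<open>The residual \<open>v - proj_direction V v\<close> is orthogonal to every direction of
  \<open>V\<close>; along \<open>V\<close>, \<open>\<pi>\<close> may thus be replaced by its
  projection.\<close>

lemma
  fixes V :: "'a::euclidean_space set"
  assumes "affine V" "V \<noteq> {}"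
  shows proj_direction_in_direction_space: "proj_direction V v \<in> direction_space V"
    and inner_direction_eq_proj:
      "d \<in> direction_space V \<Longrightarrow> v \<bullet> d = proj_direction V v \<bullet> d"
  using proj_direction_eq_iff[OF assms, of v "proj_direction V v"]
  by (auto simp: orthogonal_def inner_diff_left)

lemma strictly_between_if_not_in_split_hull:
  assumes "x \<in> P - split_hull P \<pi> \<pi>\<^sub>0"
  shows "of_int \<pi>\<^sub>0 < \<pi> \<bullet> x" "\<pi> \<bullet> x < of_int \<pi>\<^sub>0 + 1"
proof -
  have "x \<notin> {x \<in> P. \<pi> \<bullet> x \<le> of_int \<pi>\<^sub>0} \<union> {x \<in> P. \<pi> \<bullet> x \<ge> of_int \<pi>\<^sub>0 + 1}"
    using assms unfolding split_hull_def by (blast intro: hull_inc)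
  then show "of_int \<pi>\<^sub>0 < \<pi> \<bullet> x" "\<pi> \<bullet> x < of_int \<pi>\<^sub>0 + 1"
    using assms by auto
qed

theorem theorem3:
  fixes P V :: "(real ^ 'n) set" and \<pi> x :: "real ^ 'n" and \<pi>\<^sub>0 :: int
  assumes "V = affine hull P"
    and "\<pi> \<in> integer_points"
    and "x \<in> P - split_hull P \<pi> \<pi>\<^sub>0"
  shows "(proj_direction V \<pi> = 0 \<longrightarrow>
            split_hull P \<pi> \<pi>\<^sub>0 = {} \<and> P \<inter> integer_points = {}) \<and>
         (proj_direction V \<pi> \<noteq> 0 \<longrightarrow>
            (\<exists>x'\<in>V - P. norm (x - x') \<le> 1 / norm (proj_direction V \<pi>)))"
proof (intro conjI[of "_ \<longrightarrow> _"] impI)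
  define p where "p = proj_direction V \<pi>"
  have "P \<subseteq> V"
    unfolding assms(1) by (rule hull_subset)
  then have x: "x \<in> P" "x \<in> V"
    using assms(3) by auto
  have V: "affine V" "V \<noteq> {}"
    using assms(1) x by auto
  note between = strictly_between_if_not_in_split_hull[OF assms(3)]
  {
    assume "proj_direction V \<pi> = 0"
    then have "\<pi> \<bullet> (y - x) = 0" if "y \<in> V" for y
      using inner_direction_eq_proj[OF V, of "y - x" \<pi>] that x
      by (auto simp: direction_space_def)
    then have const: "\<pi> \<bullet> y = \<pi> \<bullet> x" if "y \<in> P" for y
      using that \<open>P \<subseteq> V\<close> by (auto simp: inner_diff_right)
    \<comment> \<open>The constant value of \<open>\<pi> \<bullet> y\<close> on \<open>P\<close>
      lies strictly between \<open>\<pi>\<^sub>0\<close> and \<open>\<pi>\<^sub>0 + 1\<close>, so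
      neither piece has a point.\<close>
    have "{y \<in> P. \<pi> \<bullet> y \<le> of_int \<pi>\<^sub>0} \<union> {y \<in> P. \<pi> \<bullet> y \<ge> of_int \<pi>\<^sub>0 + 1} = {}"
      using const between by fastforce
    then have "split_hull P \<pi> \<pi>\<^sub>0 = {}"
      unfolding split_hull_def by simp
    moreover have "y \<notin> integer_points" if "y \<in> P" for y
    proof
      assume "y \<in> integer_points"
      then have "\<pi> \<bullet> x \<in> \<int>"
        using inner_integer_points[OF assms(2)] const[OF that] by metis
      then obtain k where "\<pi> \<bullet> x = of_int k"
        by (elim Ints_cases)
      then show False
        using between by simp
    qed
    ultimately show "split_hull P \<pi> \<pi>\<^sub>0 = {} \<and> P \<inter> integer_points = {}"
      by blast
  next
    assume "proj_direction V \<pi> \<noteq> 0"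
    then have "p \<noteq> 0"
      by (simp add: p_def)
    have p: "p \<in> direction_space V"
      unfolding p_def by (rule proj_direction_in_direction_space[OF V])
    have inner_p: "\<pi> \<bullet> p = p \<bullet> p"
      using inner_direction_eq_proj[OF V, of p \<pi>] p by (simp add: p_def)
    \<comment> \<open>Since \<open>\<pi> \<bullet> p = p \<bullet> p\<close>, dividing by
      \<open>p \<bullet> p\<close> makes \<open>t\<close> exactly the change of
      \<open>\<pi> \<bullet> y\<close> along the line.\<close>
    define z where "z t = x + (t / (p \<bullet> p)) *\<^sub>R p" for t
    have z_in: "z t \<in> V" for t
      unfolding z_def by (rule affine_add_direction[OF V(1) x(2) p])
    have inner_z: "\<pi> \<bullet> z t = \<pi> \<bullet> x + t" for t
      using \<open>p \<noteq> 0\<close> by (simp add: z_def inner_add_right inner_p)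
    have dist_z: "norm (x - z t) = \<bar>t\<bar> / norm p" for t
      using \<open>p \<noteq> 0\<close> by (simp add: z_def dot_square_norm power2_eq_square)
    \<comment> \<open>With this offset, \<open>z (- a)\<close> and \<open>z (1 - a)\<close> are the
      points of the line on the two hyperplanes.\<close>
    define a where "a = \<pi> \<bullet> x - of_int \<pi>\<^sub>0"
    have a: "0 < a" "a < 1"
      using between by (auto simp: a_def)
    have "z (- a) \<notin> P \<or> z (1 - a) \<notin> P"
    proof (rule ccontr)
      assume "\<not> ?thesis"
      then have "z (- a) \<in> split_hull P \<pi> \<pi>\<^sub>0" "z (1 - a) \<in> split_hull P \<pi> \<pi>\<^sub>0"
        unfolding split_hull_def by (auto intro!: hull_inc simp: inner_z a_def)
      moreover have "convex (split_hull P \<pi> \<pi>\<^sub>0)"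
        unfolding split_hull_def by simp
      \<comment> \<open>The weights make the displacements from \<open>x\<close> cancel: (1 - a)(-a)
        + a(1 - a) = 0.\<close>
      ultimately have "(1 - a) *\<^sub>R z (- a) + a *\<^sub>R z (1 - a) \<in> split_hull P \<pi> \<pi>\<^sub>0"
        using a by (intro convexD) auto
      also have "(1 - a) *\<^sub>R z (- a) + a *\<^sub>R z (1 - a) = x"
        by (simp add: z_def algebra_simps)
      finally show False
        using assms(3) by blast
    qed
    \<comment> \<open>Whichever endpoint misses \<open>P\<close>, its parameter is at most 1 in
      absolute value, which gives the distance bound.\<close>
    then obtain t where t: "z t \<notin> P" "\<bar>t\<bar> \<le> 1"
      using a that[of "- a"] that[of "1 - a"] by auto
    show "\<exists>x'\<in>V - P. norm (x - x') \<le> 1 / norm (proj_direction V \<pi>)"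
    proof
      show "norm (x - z t) \<le> 1 / norm (proj_direction V \<pi>)"
        using t(2) unfolding dist_z p_def by (rule divide_right_mono) simp
    qed (use t z_in in blast)
  }
qed
end
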